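(* Let $G$ be a connected real $4$-dimensional Lie group and let $\{X_1,X_2,X_3,X_4\}$ be a global basis of left invariant vector fields on $G$ (determining its Lie algebra). Let $g$ be the left invariant Riemannian metric with $g(X_i,X_i)=1$ for all $i$ and $g(X_i,X_j)=0$ for $i\neq j$, and let $P$ be the left invariant almost product structure given by $PX_1=X_3$, $PX_2=X_4$, $PX_3=X_1$, $PX_4=X_2$. Then $(G,P,g)$ is a $\mathcal{W}_3$-manifold with Killing metric $g$ if and only if there exist real numbers $\lambda_1,\lambda_2,\lambda_3,\lambda_4$ such that \[ \begin{aligned} [X_1,X_2]&=\lambda_1X_3+\lambda_2X_4, & [X_2,X_3]&=\lambda_1X_1+\lambda_3X_4,\\ [X_1,X_3]&=-\lambda_1X_2+\lambda_4X_4, & [X_2,X_4]&=\lambda_2X_1-\lambda_3X_3,\\ [X_1,X_4]&=-\lambda_2X_2-\lambda_4X_3, & [X_3,X_4]&=\lambda_4X_1+\lambda_3X_2 . \end{aligned} \]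
   Context: An almost product structure on a manifold is a $(1,1)$-tensor field $P$ with $P^2=\mathrm{id}$; together with a metric $g$ satisfying $g(Px,Py)=g(x,y)$ it gives a (pseudo-)Riemannian almost product manifold. Let $\nabla$ be the Levi-Civita connection of $g$ and $F(x,y,z)=g((\nabla_xP)y,z)$. The manifold is a $\mathcal{W}_3$-manifold if $F(x,y,z)+F(y,z,x)+F(z,x,y)=0$ for all $x,y,z$. A left invariant metric $g$ on a Lie group $G$ is called a Killing metric if $g([X,Y],Z)+g([X,Z],Y)=0$ for all left invariant vector fields $X,Y,Z$. *)

theory Defs
  imports "HOL-Analysis.Analysis" "HOL-Library.Function_Algebras"
begin

text \<open>
  Tangent vectors and vector fields are functions into a real vector space, so that the library's
  notions of span and independence apply to them once functions carry the pointwise structure.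
\<close>

instantiation "fun" :: (type, real_vector) real_vector
begin

definition scaleR_fun :: "real \<Rightarrow> ('a \<Rightarrow> 'b) \<Rightarrow> 'a \<Rightarrow> 'b"
  where "scaleR_fun c f = (\<lambda>x. c *\<^sub>R f x)"

instance
  by standard (simp_all add: scaleR_fun_def fun_eq_iff scaleR_right_distrib scaleR_left_distrib)

end

section \<open>Smooth manifolds\<close>

text \<open>Used for open \<open>S\<close> only, so that derivatives within \<open>S\<close> are ordinary derivatives.\<close>

primrec Ck_on :: "nat \<Rightarrow> 'a::euclidean_space set \<Rightarrow> ('a \<Rightarrow> 'b::real_normed_vector) \<Rightarrow> bool"
  where
    "Ck_on 0 S f \<longleftrightarrow> continuous_on S f"
  | "Ck_on (Suc k) S f \<longleftrightarrow>
       f differentiable_on S \<and> (\<forall>v. Ck_on k S (\<lambda>x. frechet_derivative f (at x) v))"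

definition smooth_on :: "'a::euclidean_space set \<Rightarrow> ('a \<Rightarrow> 'b::real_normed_vector) \<Rightarrow> bool"
  where "smooth_on S f \<longleftrightarrow> (\<forall>k. Ck_on k S f)"

type_synonym ('m, 'e) chart = "'m set \<times> ('m \<Rightarrow> 'e)"

definition is_chart :: "('m::topological_space, 'e::euclidean_space) chart \<Rightarrow> bool"
  where "is_chart c \<longleftrightarrow> (case c of (U, \<phi>) \<Rightarrow>
           open U \<and> open (\<phi> ` U) \<and> homeomorphism U (\<phi> ` U) \<phi> (inv_into U \<phi>))"

text \<open>
  The atlas need not be maximal. The Hausdorff and second countability requirements are imposed
  through the type classes of the underlying space.
\<close>

definition smooth_atlas ::
    "('m::{t2_space, second_countable_topology}, 'e::euclidean_space) chart set \<Rightarrow> bool"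
  where "smooth_atlas A \<longleftrightarrow>
           (\<forall>c\<in>A. is_chart c) \<and> (\<Union>(U, \<phi>)\<in>A. U) = UNIV \<and>
           (\<forall>(U, \<phi>)\<in>A. \<forall>(V, \<psi>)\<in>A. smooth_on (\<phi> ` (U \<inter> V)) (\<psi> \<circ> inv_into U \<phi>))"

definition smooth_map ::
    "('m::topological_space, 'e::euclidean_space) chart set \<Rightarrow>
     ('n::topological_space, 'f::euclidean_space) chart set \<Rightarrow> ('m \<Rightarrow> 'n) \<Rightarrow> bool"
  where "smooth_map A B F \<longleftrightarrow> continuous_on UNIV F \<and>
           (\<forall>(U, \<phi>)\<in>A. \<forall>(V, \<psi>)\<in>B.
              smooth_on (\<phi> ` (U \<inter> F -` V)) (\<psi> \<circ> F \<circ> inv_into U \<phi>))"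

definition prod_atlas ::
    "('m, 'e) chart set \<Rightarrow> ('n, 'f) chart set \<Rightarrow> ('m \<times> 'n, 'e \<times> 'f) chart set"
  where "prod_atlas A B = {(U \<times> V, map_prod \<phi> \<psi>) | U \<phi> V \<psi>. (U, \<phi>) \<in> A \<and> (V, \<psi>) \<in> B}"

definition smooth_functions ::
    "('m::topological_space, 'e::euclidean_space) chart set \<Rightarrow> ('m \<Rightarrow> real) set"
  where "smooth_functions A = {f. \<forall>(U, \<phi>)\<in>A. smooth_on (\<phi> ` U) (f \<circ> inv_into U \<phi>)}"

section \<open>Tangent vectors and vector fields\<close>

text \<open>
  Tangent vectors at \<open>p\<close> are the derivations at \<open>p\<close> of the algebra of smooth functions. They are
  extended by \<open>0\<close> to functions that are not smooth, so that equality of tangent vectors is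
  equality of derivations.
\<close>

type_synonym 'm tangent = "('m \<Rightarrow> real) \<Rightarrow> real"
type_synonym 'm field = "'m \<Rightarrow> 'm tangent"

definition tangent_space ::
    "('m::topological_space, 'e::euclidean_space) chart set \<Rightarrow> 'm \<Rightarrow> 'm tangent set"
  where "tangent_space A p = {v.
           (\<forall>f\<in>smooth_functions A. \<forall>h\<in>smooth_functions A.
              v (\<lambda>q. f q + h q) = v f + v h \<and>
              v (\<lambda>q. f q * h q) = f p * v h + h p * v f) \<and>
           (\<forall>c. \<forall>f\<in>smooth_functions A. v (\<lambda>q. c * f q) = c * v f) \<and>
           (\<forall>f. f \<notin> smooth_functions A \<longrightarrow> v f = 0)}"

definition vector_fields ::
    "('m::topological_space, 'e::euclidean_space) chart set \<Rightarrow> 'm field set"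
  where "vector_fields A = {X.
           (\<forall>p. X p \<in> tangent_space A p) \<and>
           (\<forall>f\<in>smooth_functions A. (\<lambda>p. X p f) \<in> smooth_functions A)}"

definition lie_bracket :: "'m field \<Rightarrow> 'm field \<Rightarrow> 'm field"
  where "lie_bracket X Y = (\<lambda>p f. X p (\<lambda>q. Y q f) - Y p (\<lambda>q. X q f))"

text \<open>The differential of \<open>F\<close>; the atlas is that of the codomain.\<close>

definition push ::
    "('n::topological_space, 'e::euclidean_space) chart set \<Rightarrow> ('m \<Rightarrow> 'n) \<Rightarrow> 'm tangent \<Rightarrow> 'n tangent"
  where "push B F v = (\<lambda>f. if f \<in> smooth_functions B then v (f \<circ> F) else 0)"

definition global_frame ::
    "('m::topological_space, 'e::euclidean_space) chart set \<Rightarrow> ('i \<Rightarrow> 'm field) \<Rightarrow> bool"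
  where "global_frame A X \<longleftrightarrow>
           (\<forall>i. X i \<in> vector_fields A) \<and>
           (\<forall>p. inj (\<lambda>i. X i p) \<and> independent (range (\<lambda>i. X i p)) \<and>
                span (range (\<lambda>i. X i p)) = tangent_space A p)"

section \<open>Metrics, connections and almost product structures\<close>

type_synonym 'm bilinear_field = "'m \<Rightarrow> 'm tangent \<Rightarrow> 'm tangent \<Rightarrow> real"
type_synonym 'm endo_field = "'m \<Rightarrow> 'm tangent \<Rightarrow> 'm tangent"
type_synonym 'm connection = "'m field \<Rightarrow> 'm field \<Rightarrow> 'm field"

definition pseudo_riemannian_metric ::
    "('m::topological_space, 'e::euclidean_space) chart set \<Rightarrow> 'm bilinear_field \<Rightarrow> bool"
  where "pseudo_riemannian_metric A g \<longleftrightarrow>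
           (\<forall>p. \<forall>u\<in>tangent_space A p. \<forall>v\<in>tangent_space A p.
              g p u v = g p v u \<and>
              (\<forall>c. g p (c *\<^sub>R u) v = c * g p u v) \<and>
              (\<forall>w\<in>tangent_space A p. g p (u + w) v = g p u v + g p w v)) \<and>
           (\<forall>p. \<forall>u\<in>tangent_space A p. (\<forall>v\<in>tangent_space A p. g p u v = 0) \<longrightarrow> u = 0) \<and>
           (\<forall>X\<in>vector_fields A. \<forall>Y\<in>vector_fields A.
              (\<lambda>p. g p (X p) (Y p)) \<in> smooth_functions A)"

definition riemannian_metric ::
    "('m::topological_space, 'e::euclidean_space) chart set \<Rightarrow> 'm bilinear_field \<Rightarrow> bool"
  where "riemannian_metric A g \<longleftrightarrow> pseudo_riemannian_metric A g \<and>
           (\<forall>p. \<forall>u\<in>tangent_space A p. u \<noteq> 0 \<longrightarrow> g p u u > 0)"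

definition tensor_field_1_1 ::
    "('m::topological_space, 'e::euclidean_space) chart set \<Rightarrow> 'm endo_field \<Rightarrow> bool"
  where "tensor_field_1_1 A P \<longleftrightarrow>
           (\<forall>p. \<forall>u\<in>tangent_space A p.
              P p u \<in> tangent_space A p \<and>
              (\<forall>c. P p (c *\<^sub>R u) = c *\<^sub>R P p u) \<and>
              (\<forall>w\<in>tangent_space A p. P p (u + w) = P p u + P p w)) \<and>
           (\<forall>X\<in>vector_fields A. (\<lambda>p. P p (X p)) \<in> vector_fields A)"

definition almost_product_structure ::
    "('m::topological_space, 'e::euclidean_space) chart set \<Rightarrow> 'm endo_field \<Rightarrow> bool"
  where "almost_product_structure A P \<longleftrightarrow> tensor_field_1_1 A P \<and>
           (\<forall>p. \<forall>u\<in>tangent_space A p. P p (P p u) = u)"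

definition affine_connection ::
    "('m::topological_space, 'e::euclidean_space) chart set \<Rightarrow> 'm connection \<Rightarrow> bool"
  where "affine_connection A D \<longleftrightarrow>
           (\<forall>X\<in>vector_fields A. \<forall>Y\<in>vector_fields A.
              D X Y \<in> vector_fields A \<and>
              (\<forall>Z\<in>vector_fields A.
                 D (X + Z) Y = D X Y + D Z Y \<and> D X (Y + Z) = D X Y + D X Z) \<and>
              (\<forall>f\<in>smooth_functions A.
                 D (\<lambda>p. f p *\<^sub>R X p) Y = (\<lambda>p. f p *\<^sub>R D X Y p) \<and>
                 D X (\<lambda>p. f p *\<^sub>R Y p) = (\<lambda>p. X p f *\<^sub>R Y p + f p *\<^sub>R D X Y p)))"

definition levi_civita ::
    "('m::topological_space, 'e::euclidean_space) chart set \<Rightarrow> 'm bilinear_field \<Rightarrow>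
     'm connection \<Rightarrow> bool"
  where "levi_civita A g D \<longleftrightarrow> affine_connection A D \<and>
           (\<forall>X\<in>vector_fields A. \<forall>Y\<in>vector_fields A. D X Y - D Y X = lie_bracket X Y) \<and>
           (\<forall>X\<in>vector_fields A. \<forall>Y\<in>vector_fields A. \<forall>Z\<in>vector_fields A. \<forall>p.
              X p (\<lambda>q. g q (Y q) (Z q)) = g p (D X Y p) (Z p) + g p (Y p) (D X Z p))"

definition almost_product_manifold ::
    "('m::{t2_space, second_countable_topology}, 'e::euclidean_space) chart set \<Rightarrow>
     'm endo_field \<Rightarrow> 'm bilinear_field \<Rightarrow> bool"
  where "almost_product_manifold A P g \<longleftrightarrow>
           smooth_atlas A \<and> almost_product_structure A P \<and> pseudo_riemannian_metric A g \<and>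
           (\<forall>p. \<forall>u\<in>tangent_space A p. \<forall>v\<in>tangent_space A p. g p (P p u) (P p v) = g p u v)"

text \<open>
  \<open>F(X, Y, Z) = g((\<nabla>\<^sub>X P) Y, Z)\<close>, where \<open>(\<nabla>\<^sub>X P) Y = \<nabla>\<^sub>X (P Y) - P (\<nabla>\<^sub>X Y)\<close> and \<open>D\<close> stands for \<open>\<nabla>\<close>.
\<close>

definition fundamental_tensor ::
    "'m endo_field \<Rightarrow> 'm bilinear_field \<Rightarrow> 'm connection \<Rightarrow>
     'm field \<Rightarrow> 'm field \<Rightarrow> 'm field \<Rightarrow> 'm \<Rightarrow> real"
  where "fundamental_tensor P g D X Y Z =
           (\<lambda>p. g p (D X (\<lambda>q. P q (Y q)) p - P p (D X Y p)) (Z p))"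

text \<open>
  By the fundamental theorem of Riemannian geometry exactly one operation on vector fields
  satisfies \<open>levi_civita A g\<close>; the existential quantifier names it.
\<close>

definition W3_manifold ::
    "('m::{t2_space, second_countable_topology}, 'e::euclidean_space) chart set \<Rightarrow>
     'm endo_field \<Rightarrow> 'm bilinear_field \<Rightarrow> bool"
  where "W3_manifold A P g \<longleftrightarrow> almost_product_manifold A P g \<and>
           (\<exists>D. levi_civita A g D \<and>
              (\<forall>X\<in>vector_fields A. \<forall>Y\<in>vector_fields A. \<forall>Z\<in>vector_fields A. \<forall>p.
                 fundamental_tensor P g D X Y Z p + fundamental_tensor P g D Y Z X p
                   + fundamental_tensor P g D Z X Y p = 0))"

section \<open>Lie groups\<close>

definition lie_group ::
    "('g::{t2_space, second_countable_topology}, 'e::euclidean_space) chart set \<Rightarrow>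
     ('g \<Rightarrow> 'g \<Rightarrow> 'g) \<Rightarrow> 'g \<Rightarrow> ('g \<Rightarrow> 'g) \<Rightarrow> bool"
  where "lie_group A mul e inve \<longleftrightarrow>
           smooth_atlas A \<and> group mul e inve \<and>
           smooth_map (prod_atlas A A) A (\<lambda>(a, b). mul a b) \<and> smooth_map A A inve"

definition left_invariant_fields ::
    "('g::topological_space, 'e::euclidean_space) chart set \<Rightarrow> ('g \<Rightarrow> 'g \<Rightarrow> 'g) \<Rightarrow> 'g field set"
  where "left_invariant_fields A mul =
           {X \<in> vector_fields A. \<forall>a p. X (mul a p) = push A (mul a) (X p)}"

definition left_invariant_metric ::
    "('g::topological_space, 'e::euclidean_space) chart set \<Rightarrow> ('g \<Rightarrow> 'g \<Rightarrow> 'g) \<Rightarrow>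
     'g bilinear_field \<Rightarrow> bool"
  where "left_invariant_metric A mul g \<longleftrightarrow>
           (\<forall>a p. \<forall>u\<in>tangent_space A p. \<forall>v\<in>tangent_space A p.
              g (mul a p) (push A (mul a) u) (push A (mul a) v) = g p u v)"

definition left_invariant_endo ::
    "('g::topological_space, 'e::euclidean_space) chart set \<Rightarrow> ('g \<Rightarrow> 'g \<Rightarrow> 'g) \<Rightarrow>
     'g endo_field \<Rightarrow> bool"
  where "left_invariant_endo A mul P \<longleftrightarrow>
           (\<forall>a p. \<forall>u\<in>tangent_space A p. P (mul a p) (push A (mul a) u) = push A (mul a) (P p u))"

definition killing_metric ::
    "('g::topological_space, 'e::euclidean_space) chart set \<Rightarrow> ('g \<Rightarrow> 'g \<Rightarrow> 'g) \<Rightarrow>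
     'g bilinear_field \<Rightarrow> bool"
  where "killing_metric A mul g \<longleftrightarrow>
           pseudo_riemannian_metric A g \<and> left_invariant_metric A mul g \<and>
           (\<forall>X\<in>left_invariant_fields A mul. \<forall>Y\<in>left_invariant_fields A mul.
            \<forall>Z\<in>left_invariant_fields A mul. \<forall>p.
              g p (lie_bracket X Y p) (Z p) + g p (lie_bracket X Z p) (Y p) = 0)"

end

theory Submission
  imports Defs
begin

text \<open>
  Let \<open>c i j k = g([X i, X j], X k)\<close>. The metric is a Killing metric iff \<open>c\<close> is totally
  antisymmetric, and then the four values \<open>c 1 2 3\<close>, \<open>c 1 2 4\<close>, \<open>c 2 3 4\<close>, \<open>c 1 3 4\<close> are the
  parameters \<open>\<lambda>\<^sub>1\<close>, \<open>\<lambda>\<^sub>2\<close>, \<open>\<lambda>\<^sub>3\<close>, \<open>\<lambda>\<^sub>4\<close>. The \<open>\<W>\<^sub>3\<close> condition is automatic: the Levi-Civita connection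
  is \<open>\<nabla>\<^sub>X Y = [X, Y] / 2\<close> on left invariant fields, so with \<open>T(x, y, z) = g([x, y], z)\<close> one has
  \<open>2 F(x, y, z) = T(x, P y, z) - T(x, y, P z)\<close>, whose cyclic sum vanishes because \<open>T\<close> is invariant
  under cyclic permutations.
\<close>

section \<open>The algebra of smooth functions\<close>

lemma has_derivative_frechet_on_open:
  assumes "f differentiable_on S" "open S" "x \<in> S"
  shows "(f has_derivative frechet_derivative f (at x)) (at x)"
proof -
  have "f differentiable (at x within S)"
    using assms(1,3) unfolding differentiable_on_def by blast
  then have "f differentiable (at x)"
    by (simp only: at_within_open[OF assms(3,2)])
  then show ?thesis by (simp only: frechet_derivative_works)
qed

text \<open>Openness turns agreement on \<open>S\<close> into agreement near every point of
  \<open>S\<close>, so the derivatives agree on \<open>S\<close> as well. This lets the sum and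
  product rules, known only at points of \<open>S\<close>, be substituted in the recursion of
  \<open>Ck_on\<close>.\<close>

lemma Ck_on_cong:
  assumes "open S" "\<And>x. x \<in> S \<Longrightarrow> f x = h x" "Ck_on k S f"
  shows "Ck_on k S h"
  using assms(2,3)
proof (induction k arbitrary: f h)
  case 0
  then show ?case using continuous_on_eq[of S f h] by simp
next
  case (Suc k)
  have der: "(h has_derivative frechet_derivative f (at x)) (at x)" if "x \<in> S" for x
  proof -
    have "(f has_derivative frechet_derivative f (at x)) (at x)"
      by (rule has_derivative_frechet_on_open[OF _ assms(1) that], use Suc.prems in simp)+
    then show ?thesis
      by (rule has_derivative_transform_within_open[OF _ assms(1) that]) (simp add: Suc.prems)
  qed
  have eq: "frechet_derivative f (at x) v = frechet_derivative h (at x) v" if "x \<in> S" for x v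
    using fun_cong[OF frechet_derivative_at[OF der[OF that]]] .
  have "Ck_on k S (\<lambda>x. frechet_derivative h (at x) v)" for v
    by (rule Suc.IH[OF eq]) (use Suc.prems in auto)
  moreover have "h differentiable_on S"
    unfolding differentiable_on_def differentiable_def using der has_derivative_at_withinI by blast
  ultimately show ?case by simp
qed

text \<open>Needed for products: the product rule leaves one factor undifferentiated, and that
  factor must be available in class \<open>k\<close>.\<close>

lemma Ck_on_SucD: "Ck_on (Suc k) S f \<Longrightarrow> Ck_on k S f"
proof (induction k arbitrary: f)
  case 0
  then have "f differentiable_on S" by simp
  then show ?case by (simp add: differentiable_imp_continuous_on)
next
  case (Suc k)
  have "Ck_on k S (\<lambda>x. frechet_derivative f (at x) v)" for v
    by (rule Suc.IH) (use Suc.prems Ck_on.simps(2)[of "Suc k"] in blast)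
  moreover have "f differentiable_on S"
    using Suc.prems Ck_on.simps(2)[of "Suc k"] by blast
  ultimately show ?case by (simp only: Ck_on.simps simp_thms)
qed

lemma Ck_on_const: "open S \<Longrightarrow> Ck_on k S (\<lambda>_. c)"
proof (induction k arbitrary: c)
  case (Suc k)
  have "frechet_derivative (\<lambda>_. c) (at x) = (\<lambda>_. 0)" for x :: 'a
    using frechet_derivative_at[OF has_derivative_const] by metis
  then show ?case using Suc by simp
qed simp

lemma Ck_on_add:
  assumes "open S" "Ck_on k S f" "Ck_on k S h"
  shows "Ck_on k S (\<lambda>x. f x + h x)"
  using assms(2,3)
proof (induction k arbitrary: f h)
  case 0
  then show ?case by (simp add: continuous_on_add)
next
  case (Suc k)
  have "frechet_derivative f (at x) v + frechet_derivative h (at x) v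
      = frechet_derivative (\<lambda>x. f x + h x) (at x) v" if "x \<in> S" for x v
  proof -
    have "(f has_derivative frechet_derivative f (at x)) (at x)"
      "(h has_derivative frechet_derivative h (at x)) (at x)"
      by (rule has_derivative_frechet_on_open[OF _ assms(1) that], use Suc.prems in simp)+
    from frechet_derivative_at[OF has_derivative_add[OF this]] show ?thesis by (rule fun_cong)
  qed
  then have "Ck_on k S (\<lambda>x. frechet_derivative (\<lambda>x. f x + h x) (at x) v)" for v
    by (rule Ck_on_cong[OF assms(1)]) (use Suc in auto)
  then show ?case using Suc.prems by (simp add: differentiable_on_add)
qed

lemma Ck_on_mult:
  fixes f h :: "'a::euclidean_space \<Rightarrow> real"
  assumes "open S" "Ck_on k S f" "Ck_on k S h"
  shows "Ck_on k S (\<lambda>x. f x * h x)"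
  using assms(2,3)
proof (induction k arbitrary: f h)
  case 0
  then show ?case by (simp add: continuous_on_mult)
next
  case (Suc k)
  have "f x * frechet_derivative h (at x) v + frechet_derivative f (at x) v * h x
      = frechet_derivative (\<lambda>x. f x * h x) (at x) v" if "x \<in> S" for x v
  proof -
    have "(f has_derivative frechet_derivative f (at x)) (at x)"
      "(h has_derivative frechet_derivative h (at x)) (at x)"
      by (rule has_derivative_frechet_on_open[OF _ assms(1) that], use Suc.prems in simp)+
    from frechet_derivative_at[OF has_derivative_mult[OF this]] show ?thesis by (rule fun_cong)
  qed
  \<comment> \<open>The induction hypothesis is used for two new pairs, \<open>f\<close> with a
    derivative of \<open>h\<close> and a derivative of \<open>f\<close> with
    \<open>h\<close>.\<close>
  moreover have "Ck_on k S (\<lambda>x. f x * frechet_derivative h (at x) v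
      + frechet_derivative f (at x) v * h x)" for v
    using Suc.prems Suc.IH Ck_on_SucD[OF Suc.prems(1)] Ck_on_SucD[OF Suc.prems(2)]
    by (intro Ck_on_add[OF assms(1)]) auto
  ultimately have "Ck_on k S (\<lambda>x. frechet_derivative (\<lambda>x. f x * h x) (at x) v)" for v
    by (rule Ck_on_cong[OF assms(1)])
  then show ?case using Suc.prems by (simp add: differentiable_on_mult)
qed

lemma smooth_on_const: "open S \<Longrightarrow> smooth_on S (\<lambda>_. c)"
  by (simp add: smooth_on_def Ck_on_const)

lemma smooth_on_add: "open S \<Longrightarrow> smooth_on S f \<Longrightarrow> smooth_on S h \<Longrightarrow> smooth_on S (\<lambda>x. f x + h x)"
  by (simp add: smooth_on_def Ck_on_add)

lemma smooth_on_mult: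
  fixes f h :: "'a::euclidean_space \<Rightarrow> real"
  shows "open S \<Longrightarrow> smooth_on S f \<Longrightarrow> smooth_on S h \<Longrightarrow> smooth_on S (\<lambda>x. f x * h x)"
  by (simp add: smooth_on_def Ck_on_mult)

lemma sum_fun_apply: "(\<Sum>i\<in>I. F i) x = (\<Sum>i\<in>I. F i x)"
  by (induction I rule: infinite_finite_induct) auto

lemma scaleR_fun_apply: "(c *\<^sub>R f) x = c *\<^sub>R f x"
  by (simp add: scaleR_fun_def)

section \<open>Smooth functions and derivations on a fixed manifold\<close>

locale smooth_manifold =
  fixes A :: "('m::{t2_space, second_countable_topology}, 'e::euclidean_space) chart set"
  assumes atlas: "smooth_atlas A"
begin

abbreviation "C \<equiv> smooth_functions A"
abbreviation "T \<equiv> tangent_space A"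
abbreviation "V \<equiv> vector_fields A"

lemma open_chart_image: "(U, \<phi>) \<in> A \<Longrightarrow> open (\<phi> ` U)"
  using atlas by (auto simp: smooth_atlas_def is_chart_def)

lemma smooth_const [simp]: "(\<lambda>_. c) \<in> C"
  using open_chart_image by (auto simp: smooth_functions_def comp_def intro: smooth_on_const)

lemma smooth_add [intro]: "f \<in> C \<Longrightarrow> h \<in> C \<Longrightarrow> (\<lambda>q. f q + h q) \<in> C"
  using open_chart_image by (fastforce simp: smooth_functions_def comp_def intro: smooth_on_add)

lemma smooth_mult [intro]: "f \<in> C \<Longrightarrow> h \<in> C \<Longrightarrow> (\<lambda>q. f q * h q) \<in> C"
  using open_chart_image by (fastforce simp: smooth_functions_def comp_def intro: smooth_on_mult)

lemma smooth_diff [intro]: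
  assumes "f \<in> C" "h \<in> C" shows "(\<lambda>q. f q - h q) \<in> C"
  using smooth_add[OF assms(1) smooth_mult[OF smooth_const[of "-1"] assms(2)]] by simp

lemma smooth_sum [intro]: "(\<And>i. i \<in> I \<Longrightarrow> f i \<in> C) \<Longrightarrow> (\<lambda>q. \<Sum>i\<in>I. f i q) \<in> C"
  by (induction I rule: infinite_finite_induct) auto

section \<open>Tangent vectors and vector fields\<close>

lemma tangentI:
  assumes "\<And>f h. f \<in> C \<Longrightarrow> h \<in> C \<Longrightarrow> v (\<lambda>q. f q * h q) = f p * v h + h p * v f"
    and "\<And>f h. f \<in> C \<Longrightarrow> h \<in> C \<Longrightarrow> v (\<lambda>q. f q + h q) = v f + v h"
    and "\<And>f c. f \<in> C \<Longrightarrow> v (\<lambda>q. c * f q) = c * v f"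
    and "\<And>f. f \<notin> C \<Longrightarrow> v f = 0"
  shows "v \<in> T p"
  unfolding tangent_space_def using assms by blast

lemma tangent_add: "v \<in> T p \<Longrightarrow> f \<in> C \<Longrightarrow> h \<in> C \<Longrightarrow> v (\<lambda>q. f q + h q) = v f + v h"
  by (simp add: tangent_space_def)

lemma tangent_mult: "v \<in> T p \<Longrightarrow> f \<in> C \<Longrightarrow> h \<in> C \<Longrightarrow> v (\<lambda>q. f q * h q) = f p * v h + h p * v f"
  by (simp add: tangent_space_def)

lemma tangent_cmult: "v \<in> T p \<Longrightarrow> f \<in> C \<Longrightarrow> v (\<lambda>q. c * f q) = c * v f"
  unfolding tangent_space_def by blast

lemma tangent_not_smooth: "v \<in> T p \<Longrightarrow> f \<notin> C \<Longrightarrow> v f = 0"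
  by (simp add: tangent_space_def)

text \<open>The Leibniz rule for 1 * 1 = 1 gives v 1 = 2 * v 1, so \<open>v\<close> kills 1 and, by
  homogeneity, all constants.\<close>

lemma tangent_const: "v \<in> T p \<Longrightarrow> v (\<lambda>_. c) = 0"
  using tangent_mult[of v p "\<lambda>_. 1" "\<lambda>_. 1"] tangent_cmult[of v p "\<lambda>_. 1" c] by simp

lemma tangent_sum:
  "v \<in> T p \<Longrightarrow> (\<And>i. i \<in> I \<Longrightarrow> f i \<in> C) \<Longrightarrow> v (\<lambda>q. \<Sum>i\<in>I. f i q) = (\<Sum>i\<in>I. v (f i))"
proof (induction I rule: infinite_finite_induct)
  case (insert i I)
  then show ?case using tangent_add[of v p "f i" "\<lambda>q. \<Sum>i\<in>I. f i q"] by (simp add: smooth_sum)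
qed (simp_all add: tangent_const)

lemma subspace_tangent: "subspace (T p)"
proof (rule subspaceI)
  show "0 \<in> T p"
    by (rule tangentI) simp_all
  show "u + v \<in> T p" if u: "u \<in> T p" and v: "v \<in> T p" for u v
  proof (rule tangentI)
    fix f h assume f: "f \<in> C" and h: "h \<in> C"
    show "(u + v) (\<lambda>q. f q * h q) = f p * (u + v) h + h p * (u + v) f"
      unfolding plus_fun_apply tangent_mult[OF u f h] tangent_mult[OF v f h]
      by (simp add: algebra_simps)
    show "(u + v) (\<lambda>q. f q + h q) = (u + v) f + (u + v) h"
      unfolding plus_fun_apply tangent_add[OF u f h] tangent_add[OF v f h] by simp
    show "(u + v) (\<lambda>q. c * f q) = c * (u + v) f" for c
      unfolding plus_fun_apply tangent_cmult[OF u f] tangent_cmult[OF v f]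
      by (rule distrib_left[symmetric])
  qed (use tangent_not_smooth[OF u] tangent_not_smooth[OF v] in simp)
  show "r *\<^sub>R v \<in> T p" if v: "v \<in> T p" for r v
  proof (rule tangentI)
    fix f h assume f: "f \<in> C" and h: "h \<in> C"
    show "(r *\<^sub>R v) (\<lambda>q. f q * h q) = f p * (r *\<^sub>R v) h + h p * (r *\<^sub>R v) f"
      unfolding scaleR_fun_apply tangent_mult[OF v f h] by (simp add: algebra_simps)
    show "(r *\<^sub>R v) (\<lambda>q. f q + h q) = (r *\<^sub>R v) f + (r *\<^sub>R v) h"
      unfolding scaleR_fun_apply tangent_add[OF v f h] by (rule scaleR_add_right)
    show "(r *\<^sub>R v) (\<lambda>q. c * f q) = c * (r *\<^sub>R v) f" for c
      unfolding scaleR_fun_apply tangent_cmult[OF v f] by simp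
  qed (use tangent_not_smooth[OF v] in \<open>simp add: scaleR_fun_apply\<close>)
qed

lemma field_tangent [simp]: "Y \<in> V \<Longrightarrow> Y p \<in> T p"
  unfolding vector_fields_def by blast

lemma field_smooth: "Y \<in> V \<Longrightarrow> f \<in> C \<Longrightarrow> (\<lambda>p. Y p f) \<in> C"
  unfolding vector_fields_def by blast

lemma fieldI: "(\<And>p. Y p \<in> T p) \<Longrightarrow> (\<And>f. f \<in> C \<Longrightarrow> (\<lambda>p. Y p f) \<in> C) \<Longrightarrow> Y \<in> V"
  unfolding vector_fields_def by blast

text \<open>The module structure of vector fields over smooth functions; it turns smooth coordinates
  into vector fields.\<close>

lemma field_scale_sum:
  assumes "\<And>i. i \<in> I \<Longrightarrow> a i \<in> C" "\<And>i. i \<in> I \<Longrightarrow> Y i \<in> V"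
  shows "(\<lambda>p. \<Sum>i\<in>I. a i p *\<^sub>R Y i p) \<in> V"
proof (rule fieldI)
  show "(\<Sum>i\<in>I. a i p *\<^sub>R Y i p) \<in> T p" for p
  proof (rule subspace_sum[OF subspace_tangent])
    show "a i p *\<^sub>R Y i p \<in> T p" if "i \<in> I" for i
      using subspace_scale[OF subspace_tangent field_tangent[OF assms(2)[OF that]]] .
  qed
  show "(\<lambda>p. (\<Sum>i\<in>I. a i p *\<^sub>R Y i p) f) \<in> C" if f: "f \<in> C" for f
    unfolding sum_fun_apply scaleR_fun_apply real_scaleR_def
  proof (rule smooth_sum)
    show "(\<lambda>p. a i p * Y i p f) \<in> C" if "i \<in> I" for i
      using smooth_mult[OF assms(1)[OF that] field_smooth[OF assms(2)[OF that] f]] .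
  qed
qed

text \<open>In Y (Z (f h)) the cross terms Z h * Y f + Z f * Y h are symmetric in Y and Z, so they
  cancel in the commutator and the Leibniz rule survives.\<close>

lemma lie_bracket_field:
  assumes Y: "Y \<in> V" and Z: "Z \<in> V"
  shows "lie_bracket Y Z \<in> V"
proof -
  have "lie_bracket Y Z p \<in> T p" for p
  proof -
    note YT = field_tangent[OF Y] and ZT = field_tangent[OF Z]
    note YC = field_smooth[OF Y] and ZC = field_smooth[OF Z]
    show ?thesis
    proof (rule tangentI)
      fix f h assume f: "f \<in> C" and h: "h \<in> C"
      \<comment> \<open>Stated for arbitrary fields, because it is used a second time with
        \<open>Y\<close> and \<open>Z\<close> exchanged.\<close>
      have 1: "Y p (\<lambda>q. Z q (\<lambda>r. f r * h r)) =
          f p * Y p (\<lambda>q. Z q h) + Z p h * Y p f + (h p * Y p (\<lambda>q. Z q f) + Z p f * Y p h)"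
        if YT: "\<And>p. Y p \<in> T p" and ZT: "\<And>p. Z p \<in> T p" and ZC: "\<And>f. f \<in> C \<Longrightarrow> (\<lambda>q. Z q f) \<in> C"
        for Y Z
        unfolding tangent_mult[OF ZT f h]
          tangent_add[OF YT smooth_mult[OF f ZC[OF h]] smooth_mult[OF h ZC[OF f]]]
          tangent_mult[OF YT f ZC[OF h]] tangent_mult[OF YT h ZC[OF f]] ..
      show "lie_bracket Y Z p (\<lambda>q. f q * h q) = f p * lie_bracket Y Z p h + h p * lie_bracket Y Z p f"
        using 1[of Y Z, OF YT ZT ZC] 1[of Z Y, OF ZT YT YC]
        by (simp add: lie_bracket_def algebra_simps)
      show "lie_bracket Y Z p (\<lambda>q. f q + h q) = lie_bracket Y Z p f + lie_bracket Y Z p h"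
        unfolding lie_bracket_def tangent_add[OF YT f h] tangent_add[OF ZT f h]
          tangent_add[OF YT ZC[OF f] ZC[OF h]] tangent_add[OF ZT YC[OF f] YC[OF h]] by simp
      show "lie_bracket Y Z p (\<lambda>q. c * f q) = c * lie_bracket Y Z p f" for c
        unfolding lie_bracket_def tangent_cmult[OF YT f] tangent_cmult[OF ZT f]
          tangent_cmult[OF YT ZC[OF f]] tangent_cmult[OF ZT YC[OF f]] by (simp add: right_diff_distrib)
    next
      \<comment> \<open>Here both inner functions are constantly 0, and tangent vectors kill
        constants.\<close>
      fix f assume "f \<notin> C"
      then show "lie_bracket Y Z p f = 0"
        unfolding lie_bracket_def
        by (simp add: tangent_not_smooth[OF YT] tangent_not_smooth[OF ZT] tangent_const[OF YT]
            tangent_const[OF ZT])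
    qed
  qed
  then show ?thesis
  proof (rule fieldI)
    show "(\<lambda>p. lie_bracket Y Z p f) \<in> C" if f: "f \<in> C" for f
      unfolding lie_bracket_def
      by (rule smooth_diff[OF field_smooth[OF Y field_smooth[OF Z f]] field_smooth[OF Z field_smooth[OF Y f]]])
  qed
qed

lemma lie_bracket_skew: "lie_bracket Y Z = - lie_bracket Z Y"
  by (auto simp: lie_bracket_def fun_eq_iff)

section \<open>Left invariant vector fields\<close>

lemma left_invariant_field: "Y \<in> left_invariant_fields A mul \<Longrightarrow> Y \<in> V"
  by (simp add: left_invariant_fields_def)

lemma left_invariant_apply:
  "Y \<in> left_invariant_fields A mul \<Longrightarrow> f \<in> C \<Longrightarrow> Y (mul a p) f = Y p (\<lambda>q. f (mul a q))"
  by (simp add: left_invariant_fields_def push_def comp_def)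

text \<open>With L the translation by \<open>a\<close>, left invariance reads (Y f) o L = Y (f o L)
  for smooth f. Applied to the outer and then to the inner field, it moves L through both terms of
  the bracket; on functions that are not smooth both sides vanish.\<close>

lemma lie_bracket_left_invariant:
  assumes Y: "Y \<in> left_invariant_fields A mul" and Z: "Z \<in> left_invariant_fields A mul"
  shows "lie_bracket Y Z \<in> left_invariant_fields A mul"
proof -
  note YV = left_invariant_field[OF Y] and ZV = left_invariant_field[OF Z]
  have "lie_bracket Y Z (mul a p) f = push A (mul a) (lie_bracket Y Z p) f" for a p f
  proof (cases "f \<in> C")
    case True
    then show ?thesis
      using field_smooth[OF YV True] field_smooth[OF ZV True]
      by (simp add: push_def lie_bracket_def comp_def left_invariant_apply[OF Y]
          left_invariant_apply[OF Z])
  next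
    case False
    then show ?thesis
      using tangent_not_smooth[OF field_tangent[OF lie_bracket_field[OF YV ZV]]]
      by (simp add: push_def)
  qed
  then show ?thesis
    using lie_bracket_field[OF YV ZV] by (auto simp: left_invariant_fields_def)
qed

end

section \<open>Coordinates in an orthonormal frame\<close>

locale orthonormal_frame = smooth_manifold A
  for A :: "('m::{t2_space, second_countable_topology}, 'e::euclidean_space) chart set" +
  fixes X :: "'i::finite \<Rightarrow> 'm field" and g :: "'m bilinear_field"
  assumes frame: "global_frame A X"
    and metric: "pseudo_riemannian_metric A g"
    and orthonormal: "g p (X i p) (X j p) = (if i = j then 1 else 0)"
begin

lemma frame_field [simp]: "X i \<in> V"
  using frame by (simp add: global_frame_def)

lemma metric_sym: "u \<in> T p \<Longrightarrow> v \<in> T p \<Longrightarrow> g p u v = g p v u"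
  using metric unfolding pseudo_riemannian_metric_def by blast

lemma metric_scale: "u \<in> T p \<Longrightarrow> v \<in> T p \<Longrightarrow> g p (c *\<^sub>R u) v = c * g p u v"
  using metric unfolding pseudo_riemannian_metric_def by blast

lemma metric_add: "u \<in> T p \<Longrightarrow> w \<in> T p \<Longrightarrow> v \<in> T p \<Longrightarrow> g p (u + w) v = g p u v + g p w v"
  using metric unfolding pseudo_riemannian_metric_def by blast

lemma metric_diff:
  assumes "u \<in> T p" "w \<in> T p" "v \<in> T p" shows "g p (u - w) v = g p u v - g p w v"
  using metric_add[OF subspace_diff[OF subspace_tangent assms(1,2)] assms(2,3)] by simp

lemma metric_sum:
  assumes "\<And>i. i \<in> I \<Longrightarrow> u i \<in> T p" "v \<in> T p"
  shows "g p (\<Sum>i\<in>I. u i) v = (\<Sum>i\<in>I. g p (u i) v)"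
  using assms(1)
proof (induction I rule: infinite_finite_induct)
  case (insert i I)
  have "g p (u i + sum u I) v = g p (u i) v + g p (sum u I) v"
    by (rule metric_add) (use insert.prems assms(2) in \<open>auto intro: subspace_sum[OF subspace_tangent]\<close>)
  moreover have "sum u (insert i I) = u i + sum u I"
    by (rule sum.insert[OF insert.hyps])
  moreover have "g p (sum u I) v = (\<Sum>i\<in>I. g p (u i) v)"
    using insert.IH insert.prems by simp
  ultimately show ?case using insert.hyps by (metis (no_types, lifting) sum.insert)
qed (use metric_scale[OF assms(2,2), of 0] in simp_all)

lemma metric_smooth [intro]: "Y \<in> V \<Longrightarrow> Z \<in> V \<Longrightarrow> (\<lambda>p. g p (Y p) (Z p)) \<in> C"
  using metric unfolding pseudo_riemannian_metric_def by blast

text \<open>By orthonormality, inner products with the frame are the coordinates of a tangent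
  vector; \<open>coord\<close> and \<open>of_coord\<close> turn out to be mutually inverse.\<close>

definition coord :: "'m \<Rightarrow> 'm tangent \<Rightarrow> 'i \<Rightarrow> real"
  where "coord p u k = g p u (X k p)"

definition of_coord :: "'m \<Rightarrow> ('i \<Rightarrow> real) \<Rightarrow> 'm tangent"
  where "of_coord p a = (\<Sum>k\<in>UNIV. a k *\<^sub>R X k p)"

lemma of_coord_tangent [simp]: "of_coord p a \<in> T p"
  unfolding of_coord_def
  by (intro subspace_sum[OF subspace_tangent] subspace_scale[OF subspace_tangent]) simp

lemma of_coord_field: "(\<And>k. (\<lambda>p. a p k) \<in> C) \<Longrightarrow> (\<lambda>p. of_coord p (a p)) \<in> V"
  unfolding of_coord_def by (rule field_scale_sum) simp_all

lemma metric_of_coord: "v \<in> T p \<Longrightarrow> g p (of_coord p a) v = (\<Sum>k\<in>UNIV. a k * g p (X k p) v)"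
  unfolding of_coord_def
  by (simp add: metric_sum metric_scale subspace_scale[OF subspace_tangent])

lemma coord_of_coord [simp]: "coord p (of_coord p a) = a"
proof
  fix k
  have "coord p (of_coord p a) k = (\<Sum>i\<in>UNIV. a i * g p (X i p) (X k p))"
    unfolding coord_def by (rule metric_of_coord) simp
  also have "\<dots> = (\<Sum>i\<in>UNIV. if i = k then a i else 0)"
    by (intro sum.cong) (auto simp: orthonormal)
  finally show "coord p (of_coord p a) k = a k" by simp
qed

text \<open>The difference \<open>w\<close> of \<open>u\<close> and its expansion is orthogonal to
  the frame, hence to the span of the frame, which is the whole tangent space; nondegeneracy then
  gives w = 0.\<close>

lemma of_coord_coord [simp]:
  assumes u: "u \<in> T p" shows "of_coord p (coord p u) = u"
proof -
  define w where "w = u - of_coord p (coord p u)"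
  have w: "w \<in> T p" unfolding w_def using u subspace_diff[OF subspace_tangent] by simp
  have ort: "g p (X k p) w = 0" for k
  proof -
    have "g p w (X k p) = coord p u k - coord p (of_coord p (coord p u)) k"
      unfolding w_def coord_def by (rule metric_diff[OF u of_coord_tangent field_tangent[OF frame_field]])
    then show ?thesis using metric_sym[OF w, of "X k p"] by simp
  qed
  have "g p w v = 0" if "v \<in> T p" for v
  proof -
    have "v \<in> span (range (\<lambda>i. X i p))" using frame that by (simp add: global_frame_def)
    \<comment> \<open>Membership in \<open>T p\<close> is carried through the induction because
      \<open>g p\<close> is additive only on tangent vectors.\<close>
    then have "v \<in> T p \<and> g p v w = 0"
    proof (induction rule: span_induct_alt)
      case base
      have "g p 0 w = 0"
        using metric_scale[OF w w, of 0] by simp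
      with subspace_0[OF subspace_tangent] show ?case by (rule conjI)
    next
      case (step c x y)
      then obtain i where x: "x = X i p" by auto
      have 1: "c *\<^sub>R x \<in> T p"
        unfolding x by (rule subspace_scale[OF subspace_tangent]) simp
      have "g p (c *\<^sub>R x) w = 0"
        unfolding x metric_scale[OF field_tangent[OF frame_field] w] ort by simp
      then have "g p (c *\<^sub>R x + y) w = 0"
        using metric_add[OF 1 _ w] step.IH by simp
      with subspace_add[OF subspace_tangent 1] step.IH show ?case by blast
    qed
    then show ?thesis using metric_sym[OF w] by auto
  qed
  then have "w = 0" using metric w unfolding pseudo_riemannian_metric_def by blast
  then show ?thesis by (simp add: w_def)
qed

lemma tangent_eqI: "u \<in> T p \<Longrightarrow> v \<in> T p \<Longrightarrow> coord p u = coord p v \<Longrightarrow> u = v"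
  by (metis of_coord_coord)

lemma metric_coord:
  assumes "u \<in> T p" "v \<in> T p" shows "g p u v = (\<Sum>k\<in>UNIV. coord p u k * coord p v k)"
  using metric_of_coord[OF assms(2), of "coord p u"] metric_sym[OF assms(2)] assms
  by (simp add: coord_def[of p v])

lemma tangent_apply: "u \<in> T p \<Longrightarrow> u f = (\<Sum>k\<in>UNIV. coord p u k * X k p f)"
  using fun_cong[OF of_coord_coord, of u p f]
  by (simp add: of_coord_def sum_fun_apply scaleR_fun_apply)

lemma coord_add: "u \<in> T p \<Longrightarrow> v \<in> T p \<Longrightarrow> coord p (u + v) = (\<lambda>k. coord p u k + coord p v k)"
  by (simp add: fun_eq_iff coord_def metric_add)

lemma coord_scale: "u \<in> T p \<Longrightarrow> coord p (c *\<^sub>R u) = (\<lambda>k. c * coord p u k)"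
  by (simp add: fun_eq_iff coord_def metric_scale)

lemma coord_diff: "u \<in> T p \<Longrightarrow> v \<in> T p \<Longrightarrow> coord p (u - v) = (\<lambda>k. coord p u k - coord p v k)"
  by (simp add: fun_eq_iff coord_def metric_diff)

lemma coord_smooth [simp]: "Y \<in> V \<Longrightarrow> (\<lambda>p. coord p (Y p) k) \<in> C"
  unfolding coord_def by auto

text \<open>The structure functions of the frame. They depend on the point, since the frame is not
  yet assumed left invariant.\<close>

definition struct :: "'m \<Rightarrow> 'i \<Rightarrow> 'i \<Rightarrow> 'i \<Rightarrow> real"
  where "struct p i j = coord p (lie_bracket (X i) (X j) p)"

lemma struct_skew: "struct p j i k = - struct p i j k"
  using metric_scale[of "lie_bracket (X i) (X j) p" p "X k p" "-1"]
  by (simp add: struct_def coord_def lie_bracket_field lie_bracket_skew[of "X j"])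

lemma struct_smooth [simp]: "(\<lambda>p. struct p i j k) \<in> C"
  by (simp add: struct_def lie_bracket_field)

text \<open>The part of the Lie bracket that is bilinear over functions. Up to sign it is the
  torsion of the flat connection for which the frame is parallel.\<close>

definition bracket_tensor ::
    "'m \<Rightarrow> ('i \<Rightarrow> real) \<Rightarrow> ('i \<Rightarrow> real) \<Rightarrow> 'i \<Rightarrow> real"
  where "bracket_tensor p a b k = (\<Sum>i\<in>UNIV. \<Sum>j\<in>UNIV. a i * b j * struct p i j k)"

lemma bracket_tensor_skew: "bracket_tensor p b a k = - bracket_tensor p a b k"
proof -
  have "bracket_tensor p b a k = (\<Sum>i\<in>UNIV. \<Sum>j\<in>UNIV. b j * a i * struct p j i k)"
    unfolding bracket_tensor_def by (rule sum.swap)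
  also have "\<dots> = (\<Sum>i\<in>UNIV. \<Sum>j\<in>UNIV. - (a i * b j * struct p i j k))"
    by (intro sum.cong refl) (metis struct_skew mult.commute mult_minus_right)
  finally show ?thesis by (simp add: bracket_tensor_def sum_negf)
qed

text \<open>Expand both fields in the frame and apply the product rule: differentiating the
  coefficients gives the first two terms, bracketing the frame fields gives the third.\<close>

lemma coord_lie_bracket:
  assumes Y: "Y \<in> V" and Z: "Z \<in> V"
  shows "coord p (lie_bracket Y Z p) k =
    Y p (\<lambda>q. coord q (Z q) k) - Z p (\<lambda>q. coord q (Y q) k)
      + bracket_tensor p (coord p (Y p)) (coord p (Z p)) k"
proof -
  \<comment> \<open>Splits Y (Z f) into a part of first order in \<open>f\<close> and one of second
    order; after antisymmetrization the second order part contains only brackets of frame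
    fields.\<close>
  have expand: "Y p (\<lambda>q. Z q f) = (\<Sum>k\<in>UNIV. Y p (\<lambda>q. coord q (Z q) k) * X k p f)
     + (\<Sum>i\<in>UNIV. \<Sum>j\<in>UNIV. coord p (Y p) i * coord p (Z p) j * X i p (\<lambda>q. X j q f))"
    if Y: "Y \<in> V" and Z: "Z \<in> V" and f: "f \<in> C" for Y Z f
  proof -
    note Yp = field_tangent[OF Y, of p]
    have "Y p (\<lambda>q. Z q f) = Y p (\<lambda>q. \<Sum>j\<in>UNIV. coord q (Z q) j * X j q f)"
      using tangent_apply[OF field_tangent[OF Z]] by metis
    also have "\<dots> = (\<Sum>j\<in>UNIV. coord p (Z p) j * Y p (\<lambda>q. X j q f)
        + X j p f * Y p (\<lambda>q. coord q (Z q) j))"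
      using f Z
      by (subst tangent_sum[OF Yp])
        (auto simp: tangent_mult[OF Yp] field_smooth smooth_mult)
    also have "\<dots> = (\<Sum>k\<in>UNIV. Y p (\<lambda>q. coord q (Z q) k) * X k p f)
        + (\<Sum>j\<in>UNIV. \<Sum>i\<in>UNIV. coord p (Y p) i * coord p (Z p) j * X i p (\<lambda>q. X j q f))"
      by (simp add: tangent_apply[OF Yp, of "\<lambda>q. X _ q f"] sum.distrib sum_distrib_left mult_ac)
    finally show ?thesis by (subst (asm) sum.swap)
  qed
  \<comment> \<open>The claimed coordinates. It suffices that the bracket and
    \<open>of_coord p b\<close> agree on every \<open>f\<close>; where \<open>f\<close> is not
    smooth, both give 0.\<close>
  define b where "b k = Y p (\<lambda>q. coord q (Z q) k) - Z p (\<lambda>q. coord q (Y q) k)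
      + bracket_tensor p (coord p (Y p)) (coord p (Z p)) k" for k
  have "lie_bracket Y Z p f = of_coord p b f" for f
  proof (cases "f \<in> C")
    case True
    have br: "X i p (\<lambda>q. X j q f) - X j p (\<lambda>q. X i q f) = (\<Sum>k\<in>UNIV. struct p i j k * X k p f)"
      for i j
      using tangent_apply[of "lie_bracket (X i) (X j) p" p f]
      by (simp add: lie_bracket_field struct_def, simp add: lie_bracket_def)
    have "(\<Sum>i\<in>UNIV. \<Sum>j\<in>UNIV. coord p (Z p) i * coord p (Y p) j * X i p (\<lambda>q. X j q f))
       = (\<Sum>i\<in>UNIV. \<Sum>j\<in>UNIV. coord p (Y p) i * coord p (Z p) j * X j p (\<lambda>q. X i q f))"
      by (subst sum.swap) (simp add: mult_ac)
    then have "lie_bracket Y Z p f =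
        (\<Sum>k\<in>UNIV. (Y p (\<lambda>q. coord q (Z q) k) - Z p (\<lambda>q. coord q (Y q) k)) * X k p f)
        + (\<Sum>i\<in>UNIV. \<Sum>j\<in>UNIV. coord p (Y p) i * coord p (Z p) j
            * (X i p (\<lambda>q. X j q f) - X j p (\<lambda>q. X i q f)))"
      by (simp add: lie_bracket_def expand Y Z True sum_subtractf algebra_simps)
    also have "(\<Sum>i\<in>UNIV. \<Sum>j\<in>UNIV. coord p (Y p) i * coord p (Z p) j
            * (X i p (\<lambda>q. X j q f) - X j p (\<lambda>q. X i q f))) =
        (\<Sum>i\<in>UNIV. \<Sum>k\<in>UNIV. \<Sum>j\<in>UNIV. coord p (Y p) i * coord p (Z p) j
            * struct p i j k * X k p f)"
      unfolding br sum_distrib_left by (subst (2) sum.swap) (simp add: mult_ac)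
    also have "\<dots> = (\<Sum>k\<in>UNIV. bracket_tensor p (coord p (Y p)) (coord p (Z p)) k * X k p f)"
      by (subst sum.swap) (simp add: bracket_tensor_def sum_distrib_right)
    finally show ?thesis
      by (simp add: of_coord_def sum_fun_apply scaleR_fun_apply b_def sum.distrib distrib_right)
  next
    case False
    then show ?thesis
      using tangent_not_smooth[OF field_tangent[OF lie_bracket_field[OF Y Z]]]
        tangent_not_smooth[OF of_coord_tangent] by simp
  qed
  then have "lie_bracket Y Z p = of_coord p b" by blast
  then show ?thesis by (simp add: b_def)
qed

section \<open>The Levi-Civita connection of a Killing frame\<close>

text \<open>The formula [Y, Z] / 2 makes sense as a connection only on fields with constant
  coordinates. Differentiating the coordinates of the second field extends it to all fields, as a
  witness for \<open>levi_civita\<close> requires.\<close>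

definition half_bracket_connection :: "'m connection"
  where "half_bracket_connection Y Z = (\<lambda>p. of_coord p (\<lambda>k. Y p (\<lambda>q. coord q (Z q) k)
            + bracket_tensor p (coord p (Y p)) (coord p (Z p)) k / 2))"

abbreviation "D \<equiv> half_bracket_connection"

lemma coord_D [simp]: "coord p (D Y Z p) k =
    Y p (\<lambda>q. coord q (Z q) k) + bracket_tensor p (coord p (Y p)) (coord p (Z p)) k / 2"
  by (simp add: half_bracket_connection_def)

lemma D_tangent [simp]: "D Y Z p \<in> T p"
  by (simp add: half_bracket_connection_def)

lemma D_field: "Y \<in> V \<Longrightarrow> Z \<in> V \<Longrightarrow> D Y Z \<in> V"
  \<comment> \<open>Division by 2 becomes a product, so closure of smooth functions under sums and
    products applies.\<close>
  unfolding half_bracket_connection_def bracket_tensor_def divide_inverse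
  by (rule of_coord_field)
    (intro smooth_add smooth_mult smooth_sum smooth_const coord_smooth struct_smooth
      field_smooth[of Y, OF _ coord_smooth])

lemma bracket_tensor_bilinear:
  "bracket_tensor p (\<lambda>k. a k + b k) d k = bracket_tensor p a d k + bracket_tensor p b d k"
  "bracket_tensor p d (\<lambda>k. a k + b k) k = bracket_tensor p d a k + bracket_tensor p d b k"
  "bracket_tensor p (\<lambda>k. r * a k) d k = r * bracket_tensor p a d k"
  "bracket_tensor p d (\<lambda>k. r * a k) k = r * bracket_tensor p d a k"
  by (simp_all add: bracket_tensor_def algebra_simps sum.distrib sum_distrib_left)

lemma field_eqI:
  assumes "\<And>p. Y p \<in> T p" "\<And>p. Z p \<in> T p" "\<And>p k. coord p (Y p) k = coord p (Z p) k"
  shows "Y = Z"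
  using assms tangent_eqI by (metis ext)

text \<open>Differentiating coordinates is a connection, and adding a term bilinear over functions
  keeps it one.\<close>

lemma affine_connection_D: "affine_connection A D"
proof -
  note add = subspace_add[OF subspace_tangent] and scale = subspace_scale[OF subspace_tangent]
  have "D (Y + W) Z = D Y Z + D W Z" if Y: "Y \<in> V" and W: "W \<in> V" for Y W Z
  proof (rule field_eqI)
    show "coord p (D (Y + W) Z p) k = coord p ((D Y Z + D W Z) p) k" for p k
      by (simp add: coord_add Y W bracket_tensor_bilinear add_divide_distrib)
  qed (simp_all add: add)
  moreover have "D Y (Z + W) = D Y Z + D Y W" if Y: "Y \<in> V" and Z: "Z \<in> V" and W: "W \<in> V" for Y W Z
  proof (rule field_eqI)
    show "coord p (D Y (Z + W) p) k = coord p ((D Y Z + D Y W) p) k" for p k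
      by (simp add: coord_add Z W tangent_add[OF field_tangent[OF Y]] bracket_tensor_bilinear
          add_divide_distrib)
  qed (simp_all add: add)
  moreover have "D (\<lambda>p. f p *\<^sub>R Y p) Z = (\<lambda>p. f p *\<^sub>R D Y Z p)" if Y: "Y \<in> V" for Y Z f
  proof (rule field_eqI)
    show "coord p (D (\<lambda>p. f p *\<^sub>R Y p) Z p) k = coord p (f p *\<^sub>R D Y Z p) k" for p k
      by (simp add: coord_scale Y scaleR_fun_apply bracket_tensor_bilinear distrib_left)
  qed (simp_all add: scale)
  moreover have "D Y (\<lambda>p. f p *\<^sub>R Z p) = (\<lambda>p. Y p f *\<^sub>R Z p + f p *\<^sub>R D Y Z p)"
    if Y: "Y \<in> V" and Z: "Z \<in> V" and f: "f \<in> C" for Y Z f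
  proof (rule field_eqI)
    show "coord p (D Y (\<lambda>p. f p *\<^sub>R Z p) p) k = coord p (Y p f *\<^sub>R Z p + f p *\<^sub>R D Y Z p) k" for p k
      by (simp add: coord_add coord_scale scale Z f tangent_mult[OF field_tangent[OF Y]]
          bracket_tensor_bilinear distrib_left)
  qed (simp_all add: add scale Z)
  ultimately show ?thesis
    unfolding affine_connection_def using D_field by blast
qed

text \<open>Antisymmetry of \<open>bracket_tensor\<close> makes the two halves add up to the full
  term of \<open>coord_lie_bracket\<close>.\<close>

lemma torsion_free_D:
  assumes "Y \<in> V" "Z \<in> V" shows "D Y Z - D Z Y = lie_bracket Y Z"
proof (rule field_eqI)
  show "(D Y Z - D Z Y) p \<in> T p" for p
    using subspace_diff[OF subspace_tangent D_tangent D_tangent] by simp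
  show "coord p ((D Y Z - D Z Y) p) k = coord p (lie_bracket Y Z p) k" for p k
    using bracket_tensor_skew[of p "coord p (Z p)" "coord p (Y p)" k]
    by (simp add: coord_diff coord_lie_bracket assms)
qed (simp add: lie_bracket_field assms)

text \<open>The trilinear form T of the introduction, written in coordinates at
  \<open>p\<close>.\<close>

definition tri :: "'m \<Rightarrow> ('i \<Rightarrow> real) \<Rightarrow> ('i \<Rightarrow> real) \<Rightarrow> ('i \<Rightarrow> real) \<Rightarrow> real"
  where "tri p a b d = (\<Sum>k\<in>UNIV. bracket_tensor p a b k * d k)"

lemma tri_skew12: "tri p b a d = - tri p a b d"
  by (simp add: tri_def bracket_tensor_skew[of p b a] sum_negf)

lemma metric_D:
  "W \<in> T p \<Longrightarrow> g p (D Y Z p) W =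
     (\<Sum>k\<in>UNIV. Y p (\<lambda>q. coord q (Z q) k) * coord p W k)
       + tri p (coord p (Y p)) (coord p (Z p)) (coord p W) / 2"
  by (simp add: metric_coord tri_def distrib_right sum.distrib sum_divide_distrib)

end

text \<open>The Killing condition on the frame fields. With \<open>struct_skew\<close> it makes
  \<open>struct p\<close> totally antisymmetric.\<close>

locale killing_frame = orthonormal_frame A X g
  for A :: "('m::{t2_space, second_countable_topology}, 'e::euclidean_space) chart set"
    and X :: "'i::finite \<Rightarrow> 'm field" and g :: "'m bilinear_field" +
  assumes struct_skew23: "struct p i k j = - struct p i j k"
begin

lemma tri_skew23: "tri p a d b = - tri p a b d"
proof -
  have "tri p a d b = (\<Sum>k\<in>UNIV. \<Sum>j\<in>UNIV. \<Sum>i\<in>UNIV. a i * d j * struct p i j k * b k)"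
    unfolding tri_def bracket_tensor_def sum_distrib_right
    by (rule sum.cong[OF refl], rule sum.swap)
  also have "\<dots> = (\<Sum>j\<in>UNIV. \<Sum>k\<in>UNIV. \<Sum>i\<in>UNIV. a i * d j * struct p i j k * b k)"
    by (rule sum.swap)
  also have "\<dots> = - (\<Sum>j\<in>UNIV. \<Sum>k\<in>UNIV. \<Sum>i\<in>UNIV. a i * b k * struct p i k j * d j)"
    by (subst struct_skew23) (simp add: sum_negf mult_ac)
  also have "(\<Sum>j\<in>UNIV. \<Sum>k\<in>UNIV. \<Sum>i\<in>UNIV. a i * b k * struct p i k j * d j) = tri p a b d"
    unfolding tri_def bracket_tensor_def sum_distrib_right
    by (rule sum.cong[OF refl], rule sum.swap)
  finally show ?thesis .
qed

text \<open>A cyclic permutation is a product of two transpositions, each of which changes the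
  sign.\<close>

lemma tri_cyclic: "tri p b d a = tri p a b d"
  using tri_skew12[of p b a d] tri_skew23[of p b d a] by simp

text \<open>Compatibility with the metric: the derivative parts of \<open>D\<close> give the product
  rule for the sum of coordinate products, while the bracket parts T(Y, Z, W) / 2 and T(Y, W, Z) / 2
  cancel.\<close>

lemma levi_civita_D: "levi_civita A g D"
proof -
  have "Y p (\<lambda>q. g q (Z q) (W q)) = g p (D Y Z p) (W p) + g p (Z p) (D Y W p)"
    if Y: "Y \<in> V" and Z: "Z \<in> V" and W: "W \<in> V" for Y Z W p
  proof -
    note Yp = field_tangent[OF Y, of p]
    have "Y p (\<lambda>q. g q (Z q) (W q)) = Y p (\<lambda>q. \<Sum>k\<in>UNIV. coord q (Z q) k * coord q (W q) k)"
      using Z W by (simp add: metric_coord)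
    also have "\<dots> = (\<Sum>k\<in>UNIV. coord p (Z p) k * Y p (\<lambda>q. coord q (W q) k)
        + coord p (W p) k * Y p (\<lambda>q. coord q (Z q) k))"
      using Z W by (subst tangent_sum[OF Yp]) (auto simp: tangent_mult[OF Yp])
    also have "\<dots> = g p (D Y Z p) (W p) + g p (D Y W p) (Z p)"
      using Z W tri_skew23[of p "coord p (Y p)" "coord p (Z p)"]
      by (simp add: metric_D sum.distrib mult.commute)
    finally show ?thesis using metric_sym[of "D Y W p" p "Z p"] Z by simp
  qed
  then show ?thesis
    unfolding levi_civita_def using affine_connection_D torsion_free_D by blast
qed

end

section \<open>Almost product structures permuting the frame\<close>

context orthonormal_frame
begin

text \<open>As \<open>s\<close> is its own inverse, reindexing the sum of the \<open>X (s i)\<close>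
  by \<open>s\<close> moves the permutation from the frame to the coordinates.\<close>

lemma endo_coord:
  assumes P: "tensor_field_1_1 A P" and perm: "\<And>i p. P p (X i p) = X (s i) p"
    and invol: "\<And>i. s (s i) = i" and u: "u \<in> T p"
  shows "coord p (P p u) = coord p u \<circ> s"
proof -
  have add: "P p (v + w) = P p v + P p w" if "v \<in> T p" "w \<in> T p" for v w
    using P that unfolding tensor_field_1_1_def by blast
  have scale: "P p (r *\<^sub>R v) = r *\<^sub>R P p v" if "v \<in> T p" for r v
    using P that unfolding tensor_field_1_1_def by blast
  \<comment> \<open>Linearity of \<open>P p\<close> holds only on \<open>T p\<close>, so it is
    extended to finite sums by hand.\<close>
  have "P p (\<Sum>i\<in>I. a i *\<^sub>R X i p) = (\<Sum>i\<in>I. a i *\<^sub>R X (s i) p)" if "finite I" for I and a :: "'i \<Rightarrow> real"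
    using that
  proof (induction I rule: finite_induct)
    case empty
    have "P p 0 = 0"
      using scale[OF subspace_0[OF subspace_tangent], of 0] by simp
    then show ?case by (simp only: sum.empty)
  next
    case (insert i I)
    have 1: "a j *\<^sub>R X j p \<in> T p" for j
      by (rule subspace_scale[OF subspace_tangent]) simp
    have 2: "P p (a i *\<^sub>R X i p + (\<Sum>i\<in>I. a i *\<^sub>R X i p))
        = P p (a i *\<^sub>R X i p) + P p (\<Sum>i\<in>I. a i *\<^sub>R X i p)"
      by (rule add[OF 1 subspace_sum[OF subspace_tangent 1]])
    show ?case
      by (simp only: sum.insert[OF insert.hyps] 2 insert.IH perm
          scale[OF field_tangent[OF frame_field]])
  qed
  then have "P p (of_coord p (coord p u)) = (\<Sum>i\<in>UNIV. coord p u i *\<^sub>R X (s i) p)"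
    by (simp add: of_coord_def)
  also have "\<dots> = of_coord p (coord p u \<circ> s)"
    unfolding of_coord_def by (rule sum.reindex_bij_witness[of _ s s]) (auto simp: invol)
  finally show ?thesis using u by simp
qed

text \<open>A linear map that permutes an orthonormal basis is an isometry.\<close>

lemma almost_product_isometry:
  assumes P: "almost_product_structure A P" and perm: "\<And>i p. P p (X i p) = X (s i) p"
    and invol: "\<And>i. s (s i) = i"
  shows "almost_product_manifold A P g"
proof -
  have t: "tensor_field_1_1 A P" using P by (simp add: almost_product_structure_def)
  have "g p (P p u) (P p v) = g p u v" if u: "u \<in> T p" and v: "v \<in> T p" for p u v
  proof -
    have "P p u \<in> T p" "P p v \<in> T p"
      using t u v unfolding tensor_field_1_1_def by blast+
    then have "g p (P p u) (P p v) = (\<Sum>k\<in>UNIV. coord p u (s k) * coord p v (s k))"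
      by (simp add: metric_coord endo_coord[OF t perm invol] u v)
    also have "\<dots> = g p u v"
      unfolding metric_coord[OF u v]
      by (rule sum.reindex_bij_witness[of _ s s]) (auto simp: invol)
    finally show ?thesis .
  qed
  then show ?thesis
    using atlas metric P unfolding almost_product_manifold_def by blast
qed

end

lemma (in killing_frame) W3_manifold_permuting:
  assumes P: "almost_product_structure A P" and perm: "\<And>i p. P p (X i p) = X (s i) p"
    and invol: "\<And>i. s (s i) = i"
  shows "W3_manifold A P g"
proof -
  have t: "tensor_field_1_1 A P" using P by (simp add: almost_product_structure_def)
  note Pc = endo_coord[OF t perm invol]
  \<comment> \<open>\<open>P\<close> has constant coefficients in the frame, so the derivative parts
    of D Y (P Z) and P (D Y Z) cancel and only the bracket parts remain; the factor 2 clears their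
    halves.\<close>
  have F: "2 * fundamental_tensor P g D Y Z W p =
      tri p (coord p (Y p)) (coord p (Z p) \<circ> s) (coord p (W p))
      - tri p (coord p (Y p)) (coord p (Z p)) (coord p (W p) \<circ> s)"
    if Y: "Y \<in> V" and Z: "Z \<in> V" and W: "W \<in> V" for Y Z W p
  proof -
    have PD: "P p (D Y Z p) \<in> T p" and PW: "P p (W p) \<in> T p"
      using t D_tangent field_tangent[OF W] unfolding tensor_field_1_1_def by blast+
    \<comment> \<open>Reindexing by \<open>s\<close> shows that \<open>P\<close> is self-adjoint,
      which moves it from \<open>D Y Z\<close> to \<open>W\<close>.\<close>
    have "g p (P p (D Y Z p)) (W p) = (\<Sum>k\<in>UNIV. coord p (D Y Z p) (s k) * coord p (W p) k)"
      using W PD by (simp add: metric_coord Pc del: coord_D)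
    also have "\<dots> = (\<Sum>k\<in>UNIV. coord p (D Y Z p) k * coord p (P p (W p)) k)"
      by (rule sum.reindex_bij_witness[of _ s s]) (auto simp: invol Pc W)
    also have "\<dots> = g p (D Y Z p) (P p (W p))"
      using PW by (simp add: metric_coord)
    also have "\<dots> = (\<Sum>k\<in>UNIV. Y p (\<lambda>q. coord q (Z q) k) * coord p (W p) (s k))
       + tri p (coord p (Y p)) (coord p (Z p)) (coord p (W p) \<circ> s) / 2"
      using PW W by (simp add: metric_D Pc)
    \<comment> \<open>Brings the derivative part into the form it has in the expansion of D Y (P
      Z).\<close>
    also have "(\<Sum>k\<in>UNIV. Y p (\<lambda>q. coord q (Z q) k) * coord p (W p) (s k))
       = (\<Sum>k\<in>UNIV. Y p (\<lambda>q. coord q (Z q) (s k)) * coord p (W p) k)"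
      by (rule sum.reindex_bij_witness[of _ s s]) (auto simp: invol)
    finally show ?thesis
      using W Z PD
      by (simp add: fundamental_tensor_def metric_diff metric_D Pc comp_def)
  qed
  have "fundamental_tensor P g D Y Z W p + fundamental_tensor P g D Z W Y p
      + fundamental_tensor P g D W Y Z p = 0"
    if "Y \<in> V" "Z \<in> V" "W \<in> V" for Y Z W p
    \<comment> \<open>Up to rotation, the subtracted term of each instance is the added term of the
      next one in cyclic order.\<close>
    using F[OF that, of p] F[OF that(2,3,1), of p] F[OF that(3,1,2), of p]
    by (simp add: tri_cyclic[of p "coord p (Z p)" "coord p (W p) \<circ> s" "coord p (Y p)"]
          tri_cyclic[of p "coord p (W p)" "coord p (Y p) \<circ> s" "coord p (Z p)"]
          tri_cyclic[of p "coord p (Y p)" "coord p (Z p) \<circ> s" "coord p (W p)"])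
  then show ?thesis
    unfolding W3_manifold_def
    using almost_product_isometry[OF P perm invol] levi_civita_D by blast
qed

section \<open>Left invariant frames\<close>

text \<open>The equation \<open>mul_unit\<close> says that left translation by a point carries
  \<open>e\<close> to that point, so invariant data are determined at \<open>e\<close>.\<close>

locale left_invariant_frame = orthonormal_frame A X g
  for A :: "('m::{t2_space, second_countable_topology}, 'e::euclidean_space) chart set"
    and X :: "'i::finite \<Rightarrow> 'm field" and g :: "'m bilinear_field" +
  fixes mul :: "'m \<Rightarrow> 'm \<Rightarrow> 'm" and e :: 'm
  assumes left_invariant: "X i \<in> left_invariant_fields A mul"
    and metric_left_invariant: "left_invariant_metric A mul g"
    and mul_unit: "mul a e = a"
begin

text \<open>Translation by \<open>p\<close> carries \<open>Y e\<close> and \<open>X k e\<close> to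
  \<open>Y p\<close> and \<open>X k p\<close> and preserves the metric.\<close>

lemma coord_left_invariant:
  assumes "Y \<in> left_invariant_fields A mul"
  shows "coord p (Y p) k = coord e (Y e) k"
proof -
  have push: "Z (mul p e) = push A (mul p) (Z e)" if "Z \<in> left_invariant_fields A mul" for Z
    using that unfolding left_invariant_fields_def by blast
  have "Y e \<in> T e" using left_invariant_field[OF assms] by simp
  then have "g (mul p e) (push A (mul p) (Y e)) (push A (mul p) (X k e)) = g e (Y e) (X k e)"
    using metric_left_invariant field_tangent[OF frame_field]
    unfolding left_invariant_metric_def by blast
  then show ?thesis
    unfolding coord_def push[OF assms, symmetric] push[OF left_invariant, symmetric] mul_unit .
qed

lemma struct_const: "struct p i j k = struct e i j k"
  unfolding struct_def
  by (rule coord_left_invariant[OF lie_bracket_left_invariant[OF left_invariant left_invariant]])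

lemma lie_bracket_frame: "lie_bracket (X i) (X j) = (\<Sum>k\<in>UNIV. struct e i j k *\<^sub>R X k)"
proof
  fix p
  have "lie_bracket (X i) (X j) p = of_coord p (struct p i j)"
    by (simp add: struct_def lie_bracket_field)
  then show "lie_bracket (X i) (X j) p = (\<Sum>k\<in>UNIV. struct e i j k *\<^sub>R X k) p"
    by (simp add: of_coord_def struct_const[of p] sum_fun_apply scaleR_fun_apply)
qed

text \<open>Uniqueness of coordinates: reads structure constants off a given bracket table.\<close>

lemma struct_unique:
  assumes "lie_bracket (X i) (X j) = (\<Sum>k\<in>UNIV. a k *\<^sub>R X k)"
  shows "struct p i j = a"
  using coord_of_coord[of p a] by (simp add: struct_def assms of_coord_def sum_fun_apply scaleR_fun_apply)

text \<open>One direction specializes to the frame. Conversely, left invariant fields have constant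
  coordinates, so the derivative terms of their bracket vanish and g([Y, Z], W) is
  \<open>tri\<close>, which is skew in its last two arguments.\<close>

lemma killing_metric_iff:
  "killing_metric A mul g \<longleftrightarrow> (\<forall>i j k. struct e i k j = - struct e i j k)"
proof
  assume "killing_metric A mul g"
  then have "coord p (lie_bracket (X i) (X j) p) k + coord p (lie_bracket (X i) (X k) p) j = 0" for i j k p
    using left_invariant unfolding killing_metric_def coord_def by blast
  then show "\<forall>i j k. struct e i k j = - struct e i j k"
    by (simp add: struct_def eq_neg_iff_add_eq_0 add.commute)
next
  assume "\<forall>i j k. struct e i k j = - struct e i j k"
  then interpret killing_frame A X g
    by unfold_locales (subst (1 2) struct_const, blast)
  have "g p (lie_bracket Y Z p) (W p) + g p (lie_bracket Y W p) (Z p) = 0"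
    if Y: "Y \<in> left_invariant_fields A mul" and Z: "Z \<in> left_invariant_fields A mul"
      and W: "W \<in> left_invariant_fields A mul" for Y Z W p
  proof -
    have br: "g p (lie_bracket Y Z p) (W p) = tri p (coord p (Y p)) (coord p (Z p)) (coord p (W p))"
      if Y: "Y \<in> left_invariant_fields A mul" and Z: "Z \<in> left_invariant_fields A mul"
        and W: "W \<in> V" for Y Z W
    proof -
      have "(\<lambda>q. coord q (U q) k) = (\<lambda>_. coord e (U e) k)"
        if "U \<in> left_invariant_fields A mul" for U k
        using coord_left_invariant[OF that] by (rule ext)
      then have "coord p (lie_bracket Y Z p) k = bracket_tensor p (coord p (Y p)) (coord p (Z p)) k"
        for k
        using Y Z left_invariant_field[OF Y] left_invariant_field[OF Z]
        by (simp add: coord_lie_bracket tangent_const[OF field_tangent])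
      then show ?thesis
        using W left_invariant_field[OF Y] left_invariant_field[OF Z]
        by (simp add: metric_coord lie_bracket_field tri_def)
    qed
    show ?thesis
      using br[OF Y Z] br[OF Y W] left_invariant_field[OF Z] left_invariant_field[OF W]
        tri_skew23[of p "coord p (Y p)" "coord p (Z p)" "coord p (W p)"] by simp
  qed
  then show "killing_metric A mul g"
    unfolding killing_metric_def using metric metric_left_invariant by blast
qed

text \<open>Antisymmetric structure constants already force the W3 condition, so the conjunction
  reduces to the Killing condition.\<close>

lemma W3_killing_iff:
  assumes "almost_product_structure A P" "\<And>i p. P p (X i p) = X (s i) p" "\<And>i. s (s i) = i"
  shows "W3_manifold A P g \<and> killing_metric A mul g \<longleftrightarrow>
    (\<forall>i j k. struct e i k j = - struct e i j k)"
proof -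
  have "W3_manifold A P g" if skew: "\<forall>i j k. struct e i k j = - struct e i j k"
  proof -
    interpret killing_frame A X g
      by unfold_locales (subst (1 2) struct_const, use skew in blast)
    show ?thesis using W3_manifold_permuting[OF assms] .
  qed
  then show ?thesis using killing_metric_iff by blast
qed

end

section \<open>The classification in dimension four\<close>

theorem theorem3p1:
  fixes A :: "('g::{t2_space, second_countable_topology}, real ^ 4) chart set"
    and mul :: "'g \<Rightarrow> 'g \<Rightarrow> 'g" and e :: 'g and inve :: "'g \<Rightarrow> 'g"
    and X :: "4 \<Rightarrow> 'g field"
    and g :: "'g bilinear_field"
    and P :: "'g endo_field"
  assumes "lie_group A mul e inve"
    and "connected (UNIV :: 'g set)"
    and "\<And>i. X i \<in> left_invariant_fields A mul"
    and "global_frame A X"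
    and "riemannian_metric A g"
    and "left_invariant_metric A mul g"
    and "\<And>i p. g p (X i p) (X i p) = 1"
    and "\<And>i j p. i \<noteq> j \<Longrightarrow> g p (X i p) (X j p) = 0"
    and "almost_product_structure A P"
    and "left_invariant_endo A mul P"
    and "\<And>p. P p (X 1 p) = X 3 p"
    and "\<And>p. P p (X 2 p) = X 4 p"
    and "\<And>p. P p (X 3 p) = X 1 p"
    and "\<And>p. P p (X 4 p) = X 2 p"
  shows "W3_manifold A P g \<and> killing_metric A mul g \<longleftrightarrow>
    (\<exists>l1 l2 l3 l4 :: real.
       lie_bracket (X 1) (X 2) = l1 *\<^sub>R X 3 + l2 *\<^sub>R X 4 \<and>
       lie_bracket (X 1) (X 3) = - l1 *\<^sub>R X 2 + l4 *\<^sub>R X 4 \<and>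
       lie_bracket (X 1) (X 4) = - l2 *\<^sub>R X 2 - l4 *\<^sub>R X 3 \<and>
       lie_bracket (X 2) (X 3) = l1 *\<^sub>R X 1 + l3 *\<^sub>R X 4 \<and>
       lie_bracket (X 2) (X 4) = l2 *\<^sub>R X 1 - l3 *\<^sub>R X 3 \<and>
       lie_bracket (X 3) (X 4) = l4 *\<^sub>R X 1 + l3 *\<^sub>R X 2)"
proof -
  interpret group mul e inve
    using assms(1) by (simp add: lie_group_def)
  interpret left_invariant_frame A X g mul e
    using assms(1,3-8) right_neutral unfolding lie_group_def riemannian_metric_def
    by unfold_locales auto
  \<comment> \<open>Arithmetic in the index type \<open>4\<close> is modulo 4, so exchanging 1 with
    3 and 2 with 4 is adding 2. The sums 5 and 6 that arise are 1 and 2.\<close>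
  have perm: "P p (X i p) = X (i + 2) p" for i p
  proof -
    have "X 5 = X 1" "X 6 = X 2" by (rule arg_cong[where f = X], simp)+
    then show ?thesis using exhaust_4[of i] assms(11-14) by auto
  qed
  have invol: "i + 2 + 2 = i" for i :: 4
    using exhaust_4[of i] by auto
  show ?thesis (is "_ \<longleftrightarrow> ?R")
    unfolding W3_killing_iff[OF assms(9) perm invol]
  proof
    assume skew: "\<forall>i j k. struct e i k j = - struct e i j k"
    \<comment> \<open>Constants with a repeated index vanish. For i < j this leaves twelve: the four
      parameters and eight even or odd permutations of them, which the next two steps express by the
      parameters.\<close>
    have "struct e i j j = 0" for i j
      using skew[rule_format, of i j j] by simp
    moreover have "struct e i j i = 0" for i j
      using skew[rule_format, of i i j] struct_skew[of e i i j] by simp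
    moreover have "struct e 2 3 1 = struct e 1 2 3" "struct e 2 4 1 = struct e 1 2 4"
      "struct e 3 4 1 = struct e 1 3 4" "struct e 3 4 2 = struct e 2 3 4"
      using skew struct_skew by metis+
    moreover have "struct e 1 3 2 = - struct e 1 2 3" "struct e 1 4 2 = - struct e 1 2 4"
      "struct e 1 4 3 = - struct e 1 3 4" "struct e 2 4 3 = - struct e 2 3 4"
      using skew by metis+
    ultimately show ?R
      by (intro exI[of _ "struct e 1 2 3"] exI[of _ "struct e 1 2 4"] exI[of _ "struct e 2 3 4"]
          exI[of _ "struct e 1 3 4"])
        (simp add: lie_bracket_frame sum_4)
  next
    assume ?R
    then obtain l1 l2 l3 l4 :: real where l:
      "lie_bracket (X 1) (X 2) = l1 *\<^sub>R X 3 + l2 *\<^sub>R X 4"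
      "lie_bracket (X 1) (X 3) = - l1 *\<^sub>R X 2 + l4 *\<^sub>R X 4"
      "lie_bracket (X 1) (X 4) = - l2 *\<^sub>R X 2 - l4 *\<^sub>R X 3"
      "lie_bracket (X 2) (X 3) = l1 *\<^sub>R X 1 + l3 *\<^sub>R X 4"
      "lie_bracket (X 2) (X 4) = l2 *\<^sub>R X 1 - l3 *\<^sub>R X 3"
      "lie_bracket (X 3) (X 4) = l4 *\<^sub>R X 1 + l3 *\<^sub>R X 2"
      by blast
    \<comment> \<open>The table determines the rows with i < j; antisymmetry in the first two
      indices supplies the diagonal and the rows below it, and the claim becomes a finite
      check.\<close>
    have upper:
      "struct e 1 2 = (\<lambda>k. if k = 3 then l1 else if k = 4 then l2 else 0)"
      "struct e 1 3 = (\<lambda>k. if k = 2 then - l1 else if k = 4 then l4 else 0)"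
      "struct e 1 4 = (\<lambda>k. if k = 2 then - l2 else if k = 3 then - l4 else 0)"
      "struct e 2 3 = (\<lambda>k. if k = 1 then l1 else if k = 4 then l3 else 0)"
      "struct e 2 4 = (\<lambda>k. if k = 1 then l2 else if k = 3 then - l3 else 0)"
      "struct e 3 4 = (\<lambda>k. if k = 1 then l4 else if k = 2 then l3 else 0)"
      by (rule struct_unique, simp add: l sum_4)+
    have diag: "struct e i i k = 0" for i k
      using struct_skew[of e i i k] by simp
    note lower = struct_skew[of e 2 1] struct_skew[of e 3 1] struct_skew[of e 4 1]
      struct_skew[of e 3 2] struct_skew[of e 4 2] struct_skew[of e 4 3]
    show "\<forall>i j k. struct e i k j = - struct e i j k"
      by (simp add: forall_4 diag lower upper)
  qed
qed

end
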